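(* Let $n \ge 1$ and let $F, G_1, G_2, G_3, G_4 : \mathbb{H}^n \to \mathbb{R}$ be quaternion Hermitian forms. Suppose that for every $x \in \mathbb{H}^n$, $$G_1(x) \ge 0,\ G_2(x) \ge 0,\ G_3(x) \ge 0,\ G_4(x) \ge 0 \;\Longrightarrow\; F(x) \ge 0,$$ and suppose that there is $x_0 \in \mathbb{H}^n$ such that $G_i(x_0) > 0$ for $i = 1,2,3,4$. Then the $\mathcal{S}$-procedure is lossless for $m=4$; that is, there exist real numbers $\tau_1, \tau_2, \tau_3, \tau_4 \ge 0$ such that $$F(x) - \sum_{i=1}^4 \tau_i G_i(x) \ge 0 \quad \text{for all } x \in \mathbb{H}^n.$$
   Context: $\mathbb{H}$ denotes the real quaternions, with basis $1, i, j, k$, where $i^2=j^2=k^2=ijk=-1$; the conjugate of $q = a+bi+cj+dk$ is $\overline{q} = a-bi-cj-dk$. Vectors in $\mathbb{H}^n$ are column vectors, and $A^H = (\overline{A})^\top$ is the conjugate transpose. A matrix $A \in \mathbb{H}^{n \times n}$ is Hermitian if $A = A^H$. A quaternion Hermitian form on $\mathbb{H}^n$ is a function $x \mapsto x^H A x$ with $A \in \mathbb{H}^{n\times n}$ Hermitian; its values are real. For functions $F, G_1, \dots, G_m$, the $\mathcal{S}$-procedure is called lossless if the condition "for all $x$: $G_1(x) \ge 0, \dots, G_m(x)\ge 0$ implies $F(x) \ge 0$" is equivalent to the condition "there exist $\tau_1,\dots,\tau_m \ge 0$ such that $F(x) - \sum_{i=1}^m \tau_i G_i(x) \ge 0$ for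 all $x$" (the second condition always implies the first). *)

theory Defs
  imports "HOL-Analysis.Analysis"
begin

section \<open>The real quaternions\<close>

text \<open>\<open>Quat a b c d\<close> stands for $a + bi + cj + dk$.\<close>

datatype quat = Quat (qRe: real) (qI: real) (qJ: real) (qK: real)

lemma quat_eq_iff: "p = q \<longleftrightarrow> qRe p = qRe q \<and> qI p = qI q \<and> qJ p = qJ q \<and> qK p = qK q"
  by (cases p; cases q) simp

instantiation quat :: real_algebra_1
begin

definition zero_quat :: quat where "0 = Quat 0 0 0 0"

definition one_quat :: quat where "1 = Quat 1 0 0 0"

definition plus_quat :: "quat \<Rightarrow> quat \<Rightarrow> quat" where
  "p + q = Quat (qRe p + qRe q) (qI p + qI q) (qJ p + qJ q) (qK p + qK q)"

definition uminus_quat :: "quat \<Rightarrow> quat" where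
  "- p = Quat (- qRe p) (- qI p) (- qJ p) (- qK p)"

definition minus_quat :: "quat \<Rightarrow> quat \<Rightarrow> quat" where
  "p - q = Quat (qRe p - qRe q) (qI p - qI q) (qJ p - qJ q) (qK p - qK q)"

definition scaleR_quat :: "real \<Rightarrow> quat \<Rightarrow> quat" where
  "r *\<^sub>R q = Quat (r * qRe q) (r * qI q) (r * qJ q) (r * qK q)"

text \<open>The bilinear extension of the multiplication table of $1, i, j, k$ checked below.\<close>

definition times_quat :: "quat \<Rightarrow> quat \<Rightarrow> quat" where
  "p * q = Quat
    (qRe p * qRe q - qI p * qI q - qJ p * qJ q - qK p * qK q)
    (qRe p * qI q + qI p * qRe q + qJ p * qK q - qK p * qJ q)
    (qRe p * qJ q - qI p * qK q + qJ p * qRe q + qK p * qI q)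
    (qRe p * qK q + qI p * qJ q - qJ p * qI q + qK p * qRe q)"

instance
  by standard
    (simp_all add: quat_eq_iff zero_quat_def one_quat_def plus_quat_def uminus_quat_def
      minus_quat_def scaleR_quat_def times_quat_def algebra_simps)

end

lemma quat_sel [simp]:
  "qRe 0 = 0" "qI 0 = 0" "qJ 0 = 0" "qK 0 = 0"
  "qRe 1 = 1" "qI 1 = 0" "qJ 1 = 0" "qK 1 = 0"
  "qRe (p + q) = qRe p + qRe q" "qI (p + q) = qI p + qI q"
  "qJ (p + q) = qJ p + qJ q" "qK (p + q) = qK p + qK q"
  "qRe (- p) = - qRe p" "qI (- p) = - qI p" "qJ (- p) = - qJ p" "qK (- p) = - qK p"
  "qRe (p - q) = qRe p - qRe q" "qI (p - q) = qI p - qI q"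
  "qJ (p - q) = qJ p - qJ q" "qK (p - q) = qK p - qK q"
  "qRe (r *\<^sub>R p) = r * qRe p" "qI (r *\<^sub>R p) = r * qI p"
  "qJ (r *\<^sub>R p) = r * qJ p" "qK (r *\<^sub>R p) = r * qK p"
  "qRe (p * q) = qRe p * qRe q - qI p * qI q - qJ p * qJ q - qK p * qK q"
  "qI (p * q) = qRe p * qI q + qI p * qRe q + qJ p * qK q - qK p * qJ q"
  "qJ (p * q) = qRe p * qJ q - qI p * qK q + qJ p * qRe q + qK p * qI q"
  "qK (p * q) = qRe p * qK q + qI p * qJ q - qJ p * qI q + qK p * qRe q"
  by (simp_all add: zero_quat_def one_quat_def plus_quat_def uminus_quat_def
      minus_quat_def scaleR_quat_def times_quat_def)

lemma quat_sel_of_real [simp]: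
  "qRe (of_real r) = r" "qI (of_real r) = 0" "qJ (of_real r) = 0" "qK (of_real r) = 0"
  by (simp_all add: of_real_def)

definition quat_i :: quat where "quat_i = Quat 0 1 0 0"
definition quat_j :: quat where "quat_j = Quat 0 0 1 0"
definition quat_k :: quat where "quat_k = Quat 0 0 0 1"

lemma quat_expansion:
  "Quat a b c d = of_real a + of_real b * quat_i + of_real c * quat_j + of_real d * quat_k"
  by (simp add: quat_eq_iff quat_i_def quat_j_def quat_k_def)

lemma quat_unit_relations:
  "quat_i * quat_i = - 1" "quat_j * quat_j = - 1" "quat_k * quat_k = - 1"
  "quat_i * quat_j * quat_k = - 1"
  by (simp_all add: quat_eq_iff quat_i_def quat_j_def quat_k_def)

definition qcnj :: "quat \<Rightarrow> quat" where
  "qcnj q = Quat (qRe q) (- qI q) (- qJ q) (- qK q)"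

lemma qcnj_sel [simp]:
  "qRe (qcnj q) = qRe q" "qI (qcnj q) = - qI q" "qJ (qcnj q) = - qJ q" "qK (qcnj q) = - qK q"
  by (simp_all add: qcnj_def)


section \<open>Quaternion Hermitian forms\<close>

definition conj_transpose :: "quat ^ 'n ^ 'm \<Rightarrow> quat ^ 'm ^ 'n" where
  "conj_transpose A = (\<chi> i j. qcnj (A $ j $ i))"

definition hermitian :: "quat ^ 'n ^ 'n \<Rightarrow> bool" where
  "hermitian A \<longleftrightarrow> A = conj_transpose A"

text \<open>The quaternion $x^H A x$.\<close>

definition herm_value :: "quat ^ 'n ^ 'n \<Rightarrow> quat ^ 'n \<Rightarrow> quat" where
  "herm_value A x = (\<Sum>i\<in>UNIV. qcnj (x $ i) * (A *v x) $ i)"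

text \<open>The coercion \<open>of_real\<close> embeds the reals in the quaternions: \<open>F\<close> is real valued and
  agrees with $x^H A x$ as a quaternion. By \<open>hermitian_form_exists\<close> below, every Hermitian
  matrix does give such an \<open>F\<close>.\<close>

definition quat_hermitian_form :: "(quat ^ 'n \<Rightarrow> real) \<Rightarrow> bool" where
  "quat_hermitian_form F \<longleftrightarrow>
    (\<exists>A :: quat ^ 'n ^ 'n. hermitian A \<and> (\<forall>x. of_real (F x) = herm_value A x))"

lemma qcnj_sum: "qcnj (sum f S) = (\<Sum>i\<in>S. qcnj (f i))"
  by (induction S rule: infinite_finite_induct) (simp_all add: quat_eq_iff)

lemma qcnj_mult: "qcnj (p * q) = qcnj q * qcnj p"
  by (simp add: quat_eq_iff algebra_simps)

lemma qcnj_qcnj [simp]: "qcnj (qcnj q) = q"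
  by (simp add: quat_eq_iff)

lemma hermitian_form_exists:
  fixes A :: "quat ^ 'n ^ 'n"
  assumes "hermitian A"
  shows "\<exists>F. \<forall>x. of_real (F x) = herm_value A x"
proof -
  have A: "qcnj (A $ i $ j) = A $ j $ i" for i j
    using assms by (metis (no_types, lifting) hermitian_def conj_transpose_def vec_lambda_beta)
  have "qcnj (herm_value A x) = herm_value A x" for x
  proof -
    have "qcnj (herm_value A x) = (\<Sum>i\<in>UNIV. \<Sum>j\<in>UNIV. qcnj (x $ j) * (A $ j $ i * x $ i))"
      by (simp add: herm_value_def matrix_vector_mult_def qcnj_sum qcnj_mult sum_distrib_right A
          mult.assoc)
    also have "\<dots> = (\<Sum>j\<in>UNIV. \<Sum>i\<in>UNIV. qcnj (x $ j) * (A $ j $ i * x $ i))"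
      by (rule sum.swap)
    also have "\<dots> = herm_value A x"
      by (simp add: herm_value_def matrix_vector_mult_def sum_distrib_left)
    finally show ?thesis .
  qed
  then have "of_real (qRe (herm_value A x)) = herm_value A x" for x
    by (simp add: quat_eq_iff)
  then show ?thesis by (intro exI[of _ "\<lambda>x. qRe (herm_value A x)"]) simp
qed

end

theory Submission
  imports Defs
begin

text \<open>The image of $\mathbb{H}^n$ under five Hermitian forms is a convex cone. Indeed, for vectors
  $x, y$ the $2 \times 2$ quaternion Hermitian matrices form a real space of dimension six, on
  which five forms restricted to the right span of $x$ and $y$ become five linear functionals.
  Moving from the identity matrix along a common kernel direction of these functionals one reaches
  a positive semidefinite matrix of rank at most one, so the value at $x$ plus the value at $y$ is
  the value at a single vector. The multipliers are then the normal vector of a hyperplane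
  separating this cone from the set of points with $F < 0$ and all $G_i \ge 0$.\<close>

section \<open>Hermitian forms as real quadratic forms, and right scaling\<close>

lemma real_quadratic_decomp:
  fixes h :: "'a::real_vector \<Rightarrow> 'a \<Rightarrow> real"
  assumes "bilinear h"
  shows "bilinear (\<lambda>u v. h u v + h v u)"
    and "h (u + v) (u + v) = h u u + h v v + (h u v + h v u)"
    and "h (r *\<^sub>R u) (r *\<^sub>R u) = r\<^sup>2 * h u u"
proof -
  note simps = bilinear_ladd[OF assms] bilinear_radd[OF assms]
    bilinear_lmul[OF assms] bilinear_rmul[OF assms]
  show "bilinear (\<lambda>u v. h u v + h v u)"
    unfolding bilinear_def by (auto intro!: linearI simp: simps algebra_simps)
  show "h (u + v) (u + v) = h u u + h v v + (h u v + h v u)"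
    by (simp add: simps)
  show "h (r *\<^sub>R u) (r *\<^sub>R u) = r\<^sup>2 * h u u"
    by (simp add: simps power2_eq_square)
qed

definition qnorm_sq :: "quat \<Rightarrow> real" where
  "qnorm_sq q = (qRe q)\<^sup>2 + (qI q)\<^sup>2 + (qJ q)\<^sup>2 + (qK q)\<^sup>2"

lemma qnorm_sq_nonneg: "0 \<le> qnorm_sq q"
  by (simp add: qnorm_sq_def)

lemma qnorm_sq_eq_0_iff: "qnorm_sq q = 0 \<longleftrightarrow> q = 0"
  by (auto simp: qnorm_sq_def quat_eq_iff add_nonneg_eq_0_iff)

lemma qnorm_sq_scaleR: "qnorm_sq (r *\<^sub>R q) = r\<^sup>2 * qnorm_sq q"
  by (simp add: qnorm_sq_def power_mult_distrib algebra_simps)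

lemma qcnj_mult_real_mult: "qcnj q * of_real r * q = of_real (qnorm_sq q * r)"
  by (simp add: quat_eq_iff qnorm_sq_def power2_eq_square algebra_simps)

text \<open>Scalars act on the right because this commutes with \<open>A *v _\<close>. The scalar
  comes last since linearity in it is used.\<close>

definition rscale :: "quat ^ 'n \<Rightarrow> quat \<Rightarrow> quat ^ 'n" where
  "rscale x q = (\<chi> i. x $ i * q)"

lemma linear_rscale: "linear (rscale x)"
  by (rule linearI) (simp_all add: rscale_def vec_eq_iff algebra_simps)

lemma qRe_sum: "qRe (sum f S) = (\<Sum>i\<in>S. qRe (f i))"
  by (induction S rule: infinite_finite_induct) simp_all

lemma herm_value_rscale: "herm_value A (rscale x q) = qcnj q * herm_value A x * q"
proof -
  have "(A *v rscale x q) $ i = (A *v x) $ i * q" for i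
    by (simp add: matrix_vector_mult_def rscale_def sum_distrib_right mult.assoc)
  then show ?thesis
    by (simp add: herm_value_def rscale_def qcnj_mult sum_distrib_left sum_distrib_right mult.assoc)
qed

text \<open>The value of the form is real, hence central, so the factors \<open>qcnj q\<close> and
  \<open>q\<close> around it combine to \<open>qnorm_sq q\<close>.\<close>

lemma quat_hermitian_form_rscale:
  assumes "quat_hermitian_form F"
  shows "F (rscale x q) = qnorm_sq q * F x"
proof -
  obtain A where A: "\<And>x. of_real (F x) = herm_value A x"
    using assms by (auto simp: quat_hermitian_form_def)
  have "of_real (F (rscale x q)) = (of_real (qnorm_sq q * F x) :: quat)"
    by (metis A herm_value_rscale qcnj_mult_real_mult)
  then show ?thesis by (metis quat_sel_of_real(1))
qed

lemma quat_hermitian_form_bilinear: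
  assumes "quat_hermitian_form F"
  obtains h where "bilinear h" "\<And>x. F x = h x x"
proof -
  obtain A where A: "\<And>x. of_real (F x) = herm_value A x"
    using assms by (auto simp: quat_hermitian_form_def)
  \<comment> \<open>Real part of the sesquilinear form of \<open>A\<close>; on the diagonal nothing
    is lost, as the value is already real there.\<close>
  define h where "h u v = qRe (\<Sum>i\<in>UNIV. qcnj (u $ i) * (A *v v) $ i)" for u v
  have "linear (h u)" for u
  proof (rule linearI)
    show "h u (v + w) = h u v + h u w" for v w
      by (simp add: h_def matrix_vector_mult_def distrib_left sum.distrib)
    show "h u (r *\<^sub>R v) = r *\<^sub>R h u v" for r v
      unfolding h_def matrix_vector_mult_def
      by (simp only: vector_scaleR_component vec_lambda_beta mult_scaleR_right
          scaleR_right.sum[symmetric] quat_sel(19)) simp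
  qed
  moreover have "linear (\<lambda>u. h u v)" for v
  proof (rule linearI)
    show "h (u + w) v = h u v + h w v" for u w
    proof -
      have "qcnj (p + q) = qcnj p + qcnj q" for p q by (simp add: quat_eq_iff)
      then show ?thesis by (simp add: h_def distrib_right sum.distrib)
    qed
    show "h (r *\<^sub>R u) v = r *\<^sub>R h u v" for r u
    proof -
      have "qcnj (r *\<^sub>R p) = r *\<^sub>R qcnj p" for p by (simp add: quat_eq_iff)
      then show ?thesis
        unfolding h_def
        by (simp only: vector_scaleR_component mult_scaleR_left
            scaleR_right.sum[symmetric] quat_sel(19)) simp
    qed
  qed
  ultimately have "bilinear h" by (simp add: bilinear_def)
  moreover have "F x = h x x" for x
    using arg_cong[OF A[of x], of qRe] by (simp add: h_def herm_value_def)
  ultimately show ?thesis using that by blast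
qed

lemma quat_hermitian_form_polar:
  assumes "quat_hermitian_form F"
  obtains c where "bilinear c" "\<And>u v. F (u + v) = F u + F v + c u v"
proof -
  obtain h where h: "bilinear h" "\<And>x. F x = h x x"
    using quat_hermitian_form_bilinear[OF assms] by blast
  show ?thesis
    using that[OF real_quadratic_decomp(1)[OF h(1)]] real_quadratic_decomp(2)[OF h(1)]
    by (simp add: h(2))
qed

lemma quat_hermitian_form_scaleR:
  assumes "quat_hermitian_form F"
  shows "F (r *\<^sub>R x) = r\<^sup>2 * F x"
proof -
  obtain h where h: "bilinear h" "\<And>x. F x = h x x"
    using quat_hermitian_form_bilinear[OF assms] by blast
  show ?thesis by (simp add: h(2) real_quadratic_decomp(3)[OF h(1)])
qed

section \<open>Linear algebra: common kernels and singular positive semidefinite shifts\<close>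

text \<open>Each functional is the inner product with its Riesz vector
  \<open>adjoint (l i) 1\<close>. Fewer than \<open>DIM('a)\<close> such vectors cannot span the
  space, so some nonzero vector is orthogonal to all of them.\<close>

lemma exists_common_kernel:
  fixes l :: "'i \<Rightarrow> 'a::euclidean_space \<Rightarrow> real"
  assumes "finite I" "card I < DIM('a)" "\<And>i. i \<in> I \<Longrightarrow> linear (l i)"
  obtains v where "v \<noteq> 0" "\<And>i. i \<in> I \<Longrightarrow> l i v = 0"
proof -
  let ?w = "\<lambda>i. adjoint (l i) 1"
  have "dim (?w ` I) \<le> card (?w ` I)"
    using assms(1) by (intro dim_le_card') auto
  also have "\<dots> < DIM('a)"
    using assms(1,2) card_image_le le_less_trans by blast
  finally obtain v where v: "v \<noteq> 0" "\<And>y. y \<in> span (?w ` I) \<Longrightarrow> orthogonal v y"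
    using orthogonal_to_subspace_exists by metis
  have "l i v = 0" if "i \<in> I" for i
  proof -
    have "v \<bullet> ?w i = 0" using v(2) that by (simp add: span_base orthogonal_def)
    then show ?thesis using adjoint_works[OF assms(3)[OF that], of v 1] by simp
  qed
  with v(1) show ?thesis using that by blast
qed

text \<open>Here \<open>- 1 / t\<close> is the eigenvalue of largest absolute value of the Hermitian matrix with
  diagonal \<open>a, b\<close> and off-diagonal entry of square norm \<open>d\<close>.\<close>

lemma exists_singular_psd_shift:
  fixes a b d :: real
  assumes "0 \<le> d" "a \<noteq> 0 \<or> b \<noteq> 0 \<or> d \<noteq> 0"
  obtains t where "0 \<le> 1 + t * a" "0 \<le> 1 + t * b" "(1 + t * a) * (1 + t * b) = t\<^sup>2 * d"
proof -
  \<comment> \<open>Nonnegative trace makes the larger eigenvalue also the one of largest absolute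
    value. Negative trace reduces to this case by negating \<open>a\<close>, \<open>b\<close> and
    \<open>t\<close>.\<close>
  have main: "\<exists>t. 0 \<le> 1 + t * a \<and> 0 \<le> 1 + t * b \<and> (1 + t * a) * (1 + t * b) = t\<^sup>2 * d"
    if s: "0 \<le> a + b" and nz: "a \<noteq> 0 \<or> b \<noteq> 0 \<or> d \<noteq> 0" for a b
  proof -
    \<comment> \<open>\<open>m\<close> is the larger root of the characteristic equation
      \<open>(m - a) * (m - b) = d\<close>, and \<open>D\<close> is the root of its
      discriminant.\<close>
    define D where "D = sqrt ((a - b)\<^sup>2 + 4 * d)"
    define m where "m = (a + b + D) / 2"
    define t where "t = - 1 / m"
    have D: "0 \<le> D" "D\<^sup>2 = (a - b)\<^sup>2 + 4 * d"
      using assms(1) by (simp_all add: D_def)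
    have "m \<noteq> 0"
    proof
      assume "m = 0"
      then have "D = 0" "a + b = 0" using D(1) s by (auto simp: m_def)
      then have "(a - b)\<^sup>2 + 4 * d = 0" using D(2) by simp
      then have "(a - b)\<^sup>2 = 0" "d = 0" using assms(1) zero_le_power2[of "a - b"] by linarith+
      then show False using nz \<open>a + b = 0\<close> by simp
    qed
    then have m: "0 < m" using s D(1) by (simp add: m_def)
    have "2 * m - (a + b) = D" by (simp add: m_def field_simps)
    with D(2) have "(2 * m - (a + b))\<^sup>2 = (a - b)\<^sup>2 + 4 * d" by simp
    then have "(m - a) * (m - b) = d" by (simp add: power2_eq_square algebra_simps)
    moreover have A: "1 + t * a = (m - a) / m" "1 + t * b = (m - b) / m"
      using m by (simp_all add: t_def field_simps)
    ultimately have prod: "(1 + t * a) * (1 + t * b) = t\<^sup>2 * d"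
      by (simp add: t_def power2_eq_square)
    have "0 \<le> (m - a) + (m - b)" using D(1) by (simp add: m_def)
    moreover have "0 \<le> (m - a) * (m - b)" using \<open>(m - a) * (m - b) = d\<close> assms(1) by simp
    ultimately have "0 \<le> m - a" "0 \<le> m - b"
      by (auto simp: zero_le_mult_iff)
    then show ?thesis using A m prod by (metis divide_nonneg_pos)
  qed
  show ?thesis
  proof (cases "0 \<le> a + b")
    case True
    then show ?thesis using main[of a b] assms(2) that by blast
  next
    case False
    then obtain t where "0 \<le> 1 + t * - a" "0 \<le> 1 + t * - b"
        "(1 + t * - a) * (1 + t * - b) = t\<^sup>2 * d"
      using main[of "- a" "- b"] assms(2) by auto
    then show ?thesis using that[of "- t"] by simp
  qed
qed

section \<open>Additivity of the joint range of five forms\<close>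

lemma quat_hermitian_forms_sum_attained:
  fixes H :: "'i \<Rightarrow> quat ^ 'n \<Rightarrow> real"
  assumes "finite I" "card I \<le> 5" "\<And>i. i \<in> I \<Longrightarrow> quat_hermitian_form (H i)"
  obtains z where "\<And>i. i \<in> I \<Longrightarrow> H i z = H i x + H i y"
proof -
  have "\<exists>c. \<forall>i\<in>I. bilinear (c i) \<and> (\<forall>u v. H i (u + v) = H i u + H i v + c i u v)"
    by (intro bchoice ballI) (metis assms(3) quat_hermitian_form_polar)
  then obtain c where c: "\<And>i. i \<in> I \<Longrightarrow> bilinear (c i)"
      "\<And>i u v. i \<in> I \<Longrightarrow> H i (u + v) = H i u + H i v + c i u v"
    by blast
  have lin: "linear (\<lambda>q. c i x (rscale y q))" if "i \<in> I" for i
    using linear_compose[OF linear_rscale, of "c i x" y] c(1)[OF that]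
    by (simp add: bilinear_def o_def)
  \<comment> \<open>The six coordinates encode the Hermitian matrix with diagonal
    \<open>a, b\<close> and off-diagonal quaternion \<open>Quat c1 c2 c3 c4\<close>;
    \<open>l i\<close> pairs it with \<open>H i\<close> on the span of \<open>x\<close> and
    \<open>y\<close>.\<close>
  define l where "l i = (\<lambda>(a, b, c1, c2, c3, c4).
    a * H i x + b * H i y + c i x (rscale y (Quat c1 c2 c3 c4)))" for i
  have "linear (l i)" if "i \<in> I" for i
  proof (rule linearI)
    fix u v :: "real \<times> real \<times> real \<times> real \<times> real \<times> real" and r :: real
    have "Quat (a + a') (b + b') (c + c') (d + d') = Quat a b c d + Quat a' b' c' d'"
      "Quat (r * a) (r * b) (r * c) (r * d) = r *\<^sub>R Quat a b c d" for a a' b b' c c' d d'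
      by (simp_all add: quat_eq_iff)
    then show "l i (u + v) = l i u + l i v" "l i (r *\<^sub>R u) = r *\<^sub>R l i u"
      by (cases u; cases v;
          simp add: l_def linear_add[OF lin[OF that]] linear_scale[OF lin[OF that]] algebra_simps)+
  qed
  moreover have "card I < DIM(real \<times> real \<times> real \<times> real \<times> real \<times> real)"
    using assms(2) by simp
  ultimately obtain v where v: "v \<noteq> 0" "\<And>i. i \<in> I \<Longrightarrow> l i v = 0"
    using exists_common_kernel[OF assms(1)] by blast
  obtain a b c1 c2 c3 c4 where "v = (a, b, c1, c2, c3, c4)" by (cases v)
  moreover define q where "q = Quat c1 c2 c3 c4"
  ultimately have nz: "a \<noteq> 0 \<or> b \<noteq> 0 \<or> qnorm_sq q \<noteq> 0"
    and ker: "\<And>i. i \<in> I \<Longrightarrow> a * H i x + b * H i y + c i x (rscale y q) = 0"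
    using v by (auto simp: l_def qnorm_sq_eq_0_iff quat_eq_iff zero_prod_def)
  obtain t where t: "0 \<le> 1 + t * a" "0 \<le> 1 + t * b"
      "(1 + t * a) * (1 + t * b) = t\<^sup>2 * qnorm_sq q"
    using exists_singular_psd_shift[OF qnorm_sq_nonneg nz] by blast
  \<comment> \<open>The singular matrix with diagonal \<open>1 + t * a\<close>,
    \<open>1 + t * b\<close> and off-diagonal entry \<open>t *\<^sub>R q\<close> is factored through
    a vector with real first entry \<open>r\<close> and second entry \<open>p\<close>.\<close>
  define r where "r = sqrt (1 + t * a)"
  have r: "r\<^sup>2 = 1 + t * a" using t(1) by (simp add: r_def)
  obtain p where p: "r *\<^sub>R p = t *\<^sub>R q" "qnorm_sq p = 1 + t * b"
  \<comment> \<open>If \<open>r = 0\<close>, singularity forces the off-diagonal entry to vanish, so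
    only the norm of \<open>p\<close> is prescribed and a real \<open>p\<close> will do. Otherwise
    \<open>p\<close> is determined by division.\<close>
  proof (cases "r = 0")
    case True
    then have "qnorm_sq (t *\<^sub>R q) = 0" using t(3) r by (simp add: qnorm_sq_scaleR)
    then have "t *\<^sub>R q = 0" by (simp only: qnorm_sq_eq_0_iff)
    then show ?thesis
      using True t(2) that[of "of_real (sqrt (1 + t * b))"] by (simp add: qnorm_sq_def)
  next
    case False
    show ?thesis
    proof (rule that)
      show "r *\<^sub>R ((t / r) *\<^sub>R q) = t *\<^sub>R q" using False by simp
      have "r\<^sup>2 \<noteq> 0" using False by simp
      then show "qnorm_sq ((t / r) *\<^sub>R q) = 1 + t * b"
        using t(3) by (simp add: qnorm_sq_scaleR power_divide flip: r) (simp add: field_simps)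
    qed
  qed
  show ?thesis
  proof (rule that)
    fix i assume i: "i \<in> I"
    have "H i (r *\<^sub>R x + rscale y p)
        = r\<^sup>2 * H i x + qnorm_sq p * H i y + r * c i x (rscale y p)"
      using c(2)[OF i] assms(3)[OF i] bilinear_lmul[OF c(1)[OF i]]
      by (simp add: quat_hermitian_form_scaleR quat_hermitian_form_rscale)
    also have "r * c i x (rscale y p) = t * c i x (rscale y q)"
      using linear_scale[OF lin[OF i], of r p] linear_scale[OF lin[OF i], of t q] p(1) by simp
    \<comment> \<open>The excess over the wanted sum is \<open>t\<close> times the kernel
      relation.\<close>
    also have "r\<^sup>2 * H i x + qnorm_sq p * H i y + \<dots>
        = H i x + H i y + t * (a * H i x + b * H i y + c i x (rscale y q))"
      by (simp add: r p(2) algebra_simps)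
    finally show "H i (r *\<^sub>R x + rscale y p) = H i x + H i y" using ker[OF i] by simp
  qed
qed

section \<open>Separation of a convex cone and the multipliers\<close>

lemma s_procedure_of_convex_cone:
  fixes F :: "'a \<Rightarrow> real" and G :: "'m::finite \<Rightarrow> 'a \<Rightarrow> real"
  assumes sum: "\<And>x y. \<exists>z. F z = F x + F y \<and> (\<forall>i. G i z = G i x + G i y)"
    and scale: "\<And>r x. 0 \<le> r \<Longrightarrow> \<exists>z. F z = r * F x \<and> (\<forall>i. G i z = r * G i x)"
    and imp: "\<And>x. (\<And>i. 0 \<le> G i x) \<Longrightarrow> 0 \<le> F x"
    and slater: "\<And>i. 0 < G i x0"
  obtains \<tau> where "\<And>i. 0 \<le> \<tau> i" "\<And>x. 0 \<le> F x - (\<Sum>i\<in>UNIV. \<tau> i * G i x)"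
proof -
  define f where "f x = (F x, \<chi> i. G i x)" for x
  \<comment> \<open>The points that would violate the implication, so \<open>imp\<close> makes
    \<open>S\<close> disjoint from the joint range.\<close>
  define S where "S = {..<0::real} \<times> {g :: real ^ 'm. \<forall>i. 0 \<le> g $ i}"
  have "convex (range f)"
  proof (rule convexI)
    fix p q and u v :: real
    assume "p \<in> range f" "q \<in> range f" and uv: "0 \<le> u" "0 \<le> v"
    then obtain x y where xy: "p = f x" "q = f y" by blast
    obtain x' y' where "F x' = u * F x" "\<forall>i. G i x' = u * G i x"
        "F y' = v * F y" "\<forall>i. G i y' = v * G i y"
      using scale[OF uv(1), of x] scale[OF uv(2), of y] by blast
    then obtain z where "F z = u * F x + v * F y" "\<forall>i. G i z = u * G i x + v * G i y"
      using sum[of x' y'] by auto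
    then have "f z = u *\<^sub>R f x + v *\<^sub>R f y" by (simp add: f_def vec_eq_iff)
    then show "u *\<^sub>R p + v *\<^sub>R q \<in> range f" unfolding xy by (metis rangeI)
  qed
  moreover have "convex S"
    unfolding S_def
  proof (rule convex_Times)
    show "convex {g :: real ^ 'm. \<forall>i. 0 \<le> g $ i}" by (simp add: convex_def)
  qed simp
  moreover have "(- 1, 0) \<in> S" by (simp add: S_def)
  then have "S \<noteq> {}" by blast
  moreover have "S \<inter> range f = {}"
    using imp by (fastforce simp: S_def f_def)
  ultimately obtain k \<beta> where k: "k \<noteq> 0" "\<And>s. s \<in> S \<Longrightarrow> k \<bullet> s \<le> \<beta>" "\<And>x. \<beta> \<le> k \<bullet> f x"
    using separating_hyperplane_sets[of S "range f"] by blast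
  obtain k0 c where kc: "k = (k0, c)" by (cases k)
  have kf: "k \<bullet> f x = k0 * F x + (\<Sum>i\<in>UNIV. c $ i * G i x)" for x
    by (simp add: kc f_def inner_vec_def)
  have kf_scale: "\<exists>z. k \<bullet> f z = r * (k \<bullet> f x)" if r: "0 \<le> r" for r x
  proof -
    obtain z where "F z = r * F x" "\<forall>i. G i z = r * G i x" using scale[OF r] by blast
    then have "f z = r *\<^sub>R f x" by (simp add: f_def vec_eq_iff)
    then have "k \<bullet> f z = r * (k \<bullet> f x)" by simp
    then show ?thesis ..
  qed
  \<comment> \<open>A linear function bounded above on a ray has nonpositive slope; this turns the
    bounds from separation into signs.\<close>
  have nonpos: "v \<le> 0" if "\<And>r::real. 0 \<le> r \<Longrightarrow> r * v \<le> w" for v w :: real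
  proof (rule ccontr)
    assume "\<not> v \<le> 0"
    then have "(\<bar>w\<bar> + 1) / v * v \<le> w" by (intro that) simp
    with \<open>\<not> v \<le> 0\<close> show False by simp
  qed
  \<comment> \<open>Scaling by 0 puts the origin into the joint range.\<close>
  have \<beta>: "\<beta> \<le> 0" using kf_scale[of 0] k(3) by (metis mult_zero_left order_refl)
  have nonneg: "0 \<le> k \<bullet> f x" for x
  proof -
    have "r * - (k \<bullet> f x) \<le> - \<beta>" if "0 \<le> r" for r
      using kf_scale[OF that, of x] k(3) by (metis mult_minus_right neg_le_iff_le)
    from nonpos[OF this] show ?thesis by simp
  qed
  have S: "k0 * s + c \<bullet> g \<le> 0" if "s < 0" "\<And>i. 0 \<le> g $ i" for s g
    using k(2)[of "(s, g)"] \<beta> that by (simp add: S_def kc)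
  have k0: "0 \<le> k0" using S[of "- 1" 0] by simp
  have c: "c $ i \<le> 0" for i
  proof (rule nonpos)
    fix r :: real assume "0 \<le> r"
    then have "0 \<le> (r *\<^sub>R axis i 1 :: real ^ 'm) $ j" for j by (simp add: axis_def)
    then show "r * c $ i \<le> k0" using S[of "- 1" "r *\<^sub>R axis i 1"] by (simp add: inner_axis)
  qed
  \<comment> \<open>The Slater point excludes a vertical hyperplane: with \<open>k0 = 0\<close> the
    nonzero, nonpositive \<open>c\<close> would give a negative value at \<open>x0\<close>.\<close>
  have "k0 \<noteq> 0"
  proof
    assume "k0 = 0"
    then have le: "0 \<le> (\<Sum>i\<in>UNIV. c $ i * G i x0)" using nonneg[of x0] kf by simp
    have nonpos_term: "c $ i * G i x0 \<le> 0" for i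
      using c[of i] slater[of i] by (simp add: mult_nonpos_nonneg)
    have "c \<noteq> 0" using k(1) kc \<open>k0 = 0\<close> by (simp add: zero_prod_def)
    then obtain j where "c $ j \<noteq> 0" by (auto simp: vec_eq_iff)
    then have "c $ j * G j x0 < 0" using c[of j] slater[of j] by (simp add: mult_neg_pos)
    then have "(\<Sum>i\<in>UNIV. c $ i * G i x0) < (\<Sum>i\<in>(UNIV::'m set). 0)"
      using nonpos_term by (intro sum_strict_mono_ex1) auto
    with le show False by simp
  qed
  with k0 have k0: "0 < k0" by simp
  show ?thesis
  proof (rule that)
    show "0 \<le> - c $ i / k0" for i using c[of i] k0 by (simp add: divide_nonpos_pos)
    show "0 \<le> F x - (\<Sum>i\<in>UNIV. - c $ i / k0 * G i x)" for x
    proof -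
      have "F x - (\<Sum>i\<in>UNIV. - c $ i / k0 * G i x) = (k \<bullet> f x) / k0"
        using k0 by (simp add: kf add_divide_distrib sum_divide_distrib sum_negf)
      then show ?thesis using nonneg k0 by simp
    qed
  qed
qed

section \<open>Application to four constraints\<close>

theorem theorem4:
  fixes F :: "quat ^ 'n \<Rightarrow> real"
    and G :: "nat \<Rightarrow> quat ^ 'n \<Rightarrow> real"
  assumes "quat_hermitian_form F"
    and "\<forall>i\<in>{1..4}. quat_hermitian_form (G i)"
    and "\<forall>x. (\<forall>i\<in>{1..4}. G i x \<ge> 0) \<longrightarrow> F x \<ge> 0"
    and "\<exists>x0. \<forall>i\<in>{1..4}. G i x0 > 0"
  shows "\<exists>\<tau> :: nat \<Rightarrow> real. (\<forall>i\<in>{1..4}. \<tau> i \<ge> 0) \<and>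
           (\<forall>x. F x - (\<Sum>i=1..4. \<tau> i * G i x) \<ge> 0)"
proof -
  have "card (UNIV :: 4 set) = card {1..4::nat}" by simp
  then obtain e :: "4 \<Rightarrow> nat" where e: "bij_betw e UNIV {1..4}"
    using finite_same_card_bij[OF finite finite_atLeastAtMost] by blast
  have range_e: "e i \<in> {1..4}" for i using e by (auto simp: bij_betw_def)
  have all_e: "(\<forall>i. P (e i)) \<longleftrightarrow> (\<forall>j\<in>{1..4}. P j)" for P
    using e by (metis UNIV_I bij_betw_iff_bijections)
  obtain x0 where x0: "\<And>i. 0 < G (e i) x0" using assms(4) range_e by blast
  \<comment> \<open>\<open>None\<close> stands for the objective, so \<open>4 option\<close> indexes
    exactly five forms.\<close>
  define H where "H j = (case j of None \<Rightarrow> F | Some i \<Rightarrow> G (e i))" for j :: "4 option"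
  have H: "quat_hermitian_form (H j)" for j
    using assms(1,2) range_e by (auto simp: H_def split: option.split)
  have card: "card (UNIV :: 4 option set) \<le> 5" by (simp add: UNIV_option_conv card_image)
  have sum: "\<exists>z. F z = F x + F y \<and> (\<forall>i. G (e i) z = G (e i) x + G (e i) y)" for x y
  proof -
    have "\<exists>z. \<forall>j. H j z = H j x + H j y"
      by (rule quat_hermitian_forms_sum_attained[where H = H and x = x and y = y, OF finite card H])
        auto
    then obtain z where z: "\<forall>j. H j z = H j x + H j y" ..
    show ?thesis using spec[OF z, of None] spec[OF z, of "Some i" for i] by (auto simp: H_def)
  qed
  have scale: "\<exists>z. F z = r * F x \<and> (\<forall>i. G (e i) z = r * G (e i) x)" if "0 \<le> r" for r x
    using that assms(1,2) range_e
    \<comment> \<open>The forms are homogeneous of degree two, hence the square root.\<close>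
    by (intro exI[of _ "sqrt r *\<^sub>R x"]) (simp add: quat_hermitian_form_scaleR)
  have imp: "0 \<le> F x" if "\<And>i. 0 \<le> G (e i) x" for x
    using assms(3) that all_e[of "\<lambda>j. 0 \<le> G j x"] by blast
  obtain \<tau> where \<tau>: "\<And>i. 0 \<le> \<tau> i" "\<And>x. 0 \<le> F x - (\<Sum>i\<in>UNIV. \<tau> i * G (e i) x)"
    by (rule s_procedure_of_convex_cone[where F = F and G = "\<lambda>i. G (e i)", OF sum scale imp x0]) auto
  \<comment> \<open>Transports the multipliers back to the indices \<open>{1..4}\<close>.\<close>
  define \<sigma> where "\<sigma> = \<tau> \<circ> inv e"
  have inj: "inj e" using e by (simp add: bij_betw_def)
  have "(\<Sum>i=1..4. \<sigma> i * G i x) = (\<Sum>i\<in>UNIV. \<tau> i * G (e i) x)" for x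
    using sum.reindex_bij_betw[OF e, of "\<lambda>i. \<sigma> i * G i x"] inj by (simp add: \<sigma>_def)
  then show ?thesis using \<tau> by (intro exI[of _ \<sigma>]) (simp add: \<sigma>_def)
qed

end
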